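(* Let $H=(V,E)$ be a nontrivial $k$-uniform $p$-hm bipartite hypergraph ($k\ge 2$) with $p$ and $k$ coprime. Then the spectrum of $H$ is $k$-symmetric.
   Context: A hypergraph $H=(V,E)$ with $V=[n]=\{1,\dots,n\}$ is $k$-uniform if every edge contains exactly $k$ vertices; it is nontrivial if it has at least one edge. A nontrivial $k$-uniform hypergraph $H=(V,E)$ is called $p$-hm bipartite if $V$ can be partitioned as $V=V_1\cup V_2$, with $V_1,V_2$ nonempty and disjoint, such that every edge of $H$ intersects $V_1$ in exactly $p$ vertices. The adjacency tensor $\mathbb{A}_H$ is the tensor of order $k$ and dimension $n$ with entries $a_{i_1\cdots i_k}=\frac{1}{(k-1)!}$ if $\{i_1,\dots,i_k\}\in E$ and $0$ otherwise. For a tensor $\mathbb{T}=(t_{i_1\cdots i_m})$ of order $m\ge2$ and dimension $n$ over $\mathbb{C}$ and $x\in\mathbb{C}^n$, $\mathbb{T}x^{m-1}\in\mathbb{C}^n$ has $i$-th component $\sum_{i_2,\dots,i_m=1}^n t_{ii_2\cdots i_m}x_{i_2}\cdots x_{i_m}$. The determinant $Det(\mathbb{T})$ is the resultant of the $n$ homogeneous polynomials $(\mathbb{T}x^{m-1})_1,\dots,(\mathbb{T}x^{m-1})_n$ in $x_1,\dots,x_n$, normalized so that $Det(\mathbb{I})=1$, where the unit tensor $\mathbb{I}$ has entries $1$ when all indices are equal and $0$ otherwise. The characteristic polynomial is $\phi_{\mathbb{T}}(\lambda)=Det(\lambda\mathbb{I}-\mathbb{T})$, a monic polynomial of degree $n(m-1)^{n-1}$;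 the spectrum of $\mathbb{T}$ is the multi-set of its roots, counted with multiplicity. The spectrum of $H$ is the spectrum of $\mathbb{A}_H$. A spectrum is $k$-symmetric if it is invariant under rotation by the angle $2\pi/k$ in the complex plane (multiplication by $e^{2\pi i/k}$). *)

theory Defs
  imports
    Complex_Main
    "HOL-Library.Poly_Mapping"
    "HOL-Library.Multiset"
    "HOL-Computational_Algebra.Computational_Algebra"
begin

section \<open>Multivariate complex polynomials\<close>

text \<open>
  Polynomials in variables from \<open>'v\<close> are finitely supported maps from exponent vectors to
  coefficients; addition and multiplication are those of \<^theory>\<open>HOL-Library.Poly_Mapping\<close>.
\<close>

type_synonym 'v mpoly = "('v \<Rightarrow>\<^sub>0 nat) \<Rightarrow>\<^sub>0 complex"

definition mpoly_eval :: "'v mpoly \<Rightarrow> ('v \<Rightarrow> complex) \<Rightarrow> complex" where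
  "mpoly_eval P c =
     (\<Sum>m\<in>Poly_Mapping.keys P. Poly_Mapping.lookup P m *
        (\<Prod>v\<in>Poly_Mapping.keys m. c v ^ Poly_Mapping.lookup m v))"

definition mpoly_vars :: "'v mpoly \<Rightarrow> 'v set" where
  "mpoly_vars P = (\<Union>m\<in>Poly_Mapping.keys P. Poly_Mapping.keys m)"

definition exponents :: "nat \<Rightarrow> nat \<Rightarrow> (nat \<Rightarrow>\<^sub>0 nat) set" where
  "exponents n d =
     {\<alpha>. Poly_Mapping.keys \<alpha> \<subseteq> {1..n} \<and>
          (\<Sum>j\<in>Poly_Mapping.keys \<alpha>. Poly_Mapping.lookup \<alpha> j) = d}"

definition homogeneous :: "nat \<Rightarrow> nat \<Rightarrow> nat mpoly \<Rightarrow> bool" where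
  "homogeneous n d F \<longleftrightarrow> Poly_Mapping.keys F \<subseteq> exponents n d"


section \<open>The resultant\<close>

text \<open>
  A polynomial in the coefficients of \<open>n\<close> forms in \<open>x\<^sub>1, \<dots>, x\<^sub>n\<close> has variables \<open>(i, \<alpha>)\<close>, standing
  for the coefficient of \<open>x\<^sup>\<alpha>\<close> in the \<open>i\<close>-th form. The map \<open>system_coeffs F\<close> substitutes the
  actual coefficients of \<open>F\<close>.
\<close>

definition system_coeffs :: "(nat \<Rightarrow> nat mpoly) \<Rightarrow> nat \<times> (nat \<Rightarrow>\<^sub>0 nat) \<Rightarrow> complex" where
  "system_coeffs F = (\<lambda>(i, \<alpha>). Poly_Mapping.lookup (F i) \<alpha>)"

definition has_nontrivial_zero :: "nat \<Rightarrow> (nat \<Rightarrow> nat mpoly) \<Rightarrow> bool" where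
  "has_nontrivial_zero n F \<longleftrightarrow>
     (\<exists>x. (\<exists>j\<in>{1..n}. x j \<noteq> 0) \<and> (\<forall>i\<in>{1..n}. mpoly_eval (F i) x = 0))"

text \<open>
  The usual characterization of the resultant of \<open>n\<close> forms of positive degrees
  \<open>d 1, \<dots>, d n\<close> in \<open>n \<ge> 1\<close> variables (see Cox, Little and O'Shea, \<^emph>\<open>Using Algebraic Geometry\<close>,
  Chapter 3, Theorem 2.3): the unique irreducible polynomial in the coefficients that vanishes
  exactly when the forms have a common nontrivial zero, normalized by
  \<open>Res(x\<^sub>1\<^bsup>d 1\<^esup>, \<dots>, x\<^sub>n\<^bsup>d n\<^esup>) = 1\<close>.
\<close>

definition is_resultant ::
    "nat \<Rightarrow> (nat \<Rightarrow> nat) \<Rightarrow> (nat \<times> (nat \<Rightarrow>\<^sub>0 nat)) mpoly \<Rightarrow> bool" where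
  "is_resultant n d R \<longleftrightarrow>
     mpoly_vars R \<subseteq> (SIGMA i:{1..n}. exponents n (d i)) \<and>
     irreducible R \<and>
     (\<forall>F. (\<forall>i\<in>{1..n}. homogeneous n (d i) (F i)) \<longrightarrow>
        (mpoly_eval R (system_coeffs F) = 0 \<longleftrightarrow> has_nontrivial_zero n F)) \<and>
     mpoly_eval R (system_coeffs
       (\<lambda>i. Poly_Mapping.single (Poly_Mapping.single i (d i)) 1)) = 1"

text \<open>
  By the classical theorem just cited, exactly one \<open>R\<close> satisfies \<open>is_resultant n d R\<close> whenever
  \<open>n \<ge> 1\<close> and all degrees are positive. The value \<open>0\<close> is only a convention for the remaining
  arguments, such as \<open>n = 0\<close>.
\<close>

definition resultant_poly ::
    "nat \<Rightarrow> (nat \<Rightarrow> nat) \<Rightarrow> (nat \<times> (nat \<Rightarrow>\<^sub>0 nat)) mpoly" where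
  "resultant_poly n d =
     (if \<exists>R. is_resultant n d R then SOME R. is_resultant n d R else 0)"

definition resultant :: "nat \<Rightarrow> (nat \<Rightarrow> nat) \<Rightarrow> (nat \<Rightarrow> nat mpoly) \<Rightarrow> complex" where
  "resultant n d F = mpoly_eval (resultant_poly n d) (system_coeffs F)"


section \<open>Tensors\<close>

text \<open>
  A tensor of order \<open>m\<close> and dimension \<open>n\<close> is a function on index lists; only its values on lists
  of length \<open>m\<close> with entries in \<open>{1..n}\<close> matter.
\<close>

type_synonym tensor = "nat list \<Rightarrow> complex"

definition unit_tensor :: tensor where
  "unit_tensor is = (if \<forall>i\<in>set is. \<forall>j\<in>set is. i = j then 1 else 0)"

text \<open>The form \<open>(T x\<^bsup>m-1\<^esup>)\<^sub>i\<close> as a polynomial in \<open>x\<^sub>1, \<dots>, x\<^sub>n\<close>.\<close>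

definition tensor_form :: "nat \<Rightarrow> nat \<Rightarrow> tensor \<Rightarrow> nat \<Rightarrow> nat mpoly" where
  "tensor_form m n T i =
     (\<Sum>is | length is = m - 1 \<and> set is \<subseteq> {1..n}.
        Poly_Mapping.single (\<Sum>j\<leftarrow>is. Poly_Mapping.single j 1) (T (i # is)))"

definition tensor_det :: "nat \<Rightarrow> nat \<Rightarrow> tensor \<Rightarrow> complex" where
  "tensor_det m n T = resultant n (\<lambda>_. m - 1) (tensor_form m n T)"

definition tensor_char_poly :: "nat \<Rightarrow> nat \<Rightarrow> tensor \<Rightarrow> complex poly" where
  "tensor_char_poly m n T =
     (THE \<phi>. \<forall>z. poly \<phi> z = tensor_det m n (\<lambda>is. z * unit_tensor is - T is))"

definition tensor_spectrum :: "nat \<Rightarrow> nat \<Rightarrow> tensor \<Rightarrow> complex multiset" where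
  "tensor_spectrum m n T = proots (tensor_char_poly m n T)"

definition k_symmetric :: "nat \<Rightarrow> complex multiset \<Rightarrow> bool" where
  "k_symmetric k S \<longleftrightarrow> image_mset (\<lambda>z. cis (2 * pi / real k) * z) S = S"


section \<open>Hypergraphs on the vertex set \<open>{1..n}\<close>\<close>

definition uniform_hypergraph :: "nat \<Rightarrow> nat \<Rightarrow> nat set set \<Rightarrow> bool" where
  "uniform_hypergraph n k E \<longleftrightarrow> (\<forall>e\<in>E. e \<subseteq> {1..n} \<and> card e = k)"

definition hm_bipartite :: "nat \<Rightarrow> nat \<Rightarrow> nat \<Rightarrow> nat set set \<Rightarrow> bool" where
  "hm_bipartite n k p E \<longleftrightarrow>
     uniform_hypergraph n k E \<and> E \<noteq> {} \<and>
     (\<exists>V1 V2. V1 \<noteq> {} \<and> V2 \<noteq> {} \<and> V1 \<inter> V2 = {} \<and> V1 \<union> V2 = {1..n} \<and>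
        (\<forall>e\<in>E. card (e \<inter> V1) = p))"

definition adjacency_tensor :: "nat \<Rightarrow> nat set set \<Rightarrow> tensor" where
  "adjacency_tensor k E is = (if set is \<in> E then 1 / fact (k - 1) else 0)"

definition hypergraph_spectrum :: "nat \<Rightarrow> nat \<Rightarrow> nat set set \<Rightarrow> complex multiset" where
  "hypergraph_spectrum n k E = tensor_spectrum k n (adjacency_tensor k E)"

end

theory Submission
  imports Defs "HOL-Number_Theory.Cong"
begin

text \<open>
  Let \<open>b j\<close> be \<open>1\<close> for vertices \<open>j\<close> in \<open>V1\<close> and \<open>0\<close> for the others. Substituting \<open>x\<^sub>j \<mapsto> s\<^bsup>b j\<^esup> x\<^sub>j\<close>
  and multiplying the \<open>i\<close>-th form of \<open>z I - A\<close> by \<open>s\<^bsup>b i + p (k - 1)\<^esup>\<close> turns it into the \<open>i\<close>-th form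
  of \<open>z s\<^bsup>k b i + p (k - 1)\<^esup> I - s\<^bsup>p k\<^esup> A\<close>, because every edge has weight \<open>p\<close>. For fixed \<open>z\<close>, the
  resultant of this system is a polynomial in \<open>s\<close> which, as the solvability of the system does not
  depend on \<open>s \<noteq> 0\<close>, has all or none of the nonzero complex numbers as roots; it is therefore a
  monomial in \<open>s\<close>. Hence the resultant has the form \<open>s\<^bsup>w\<^esup> \<phi>(z)\<close> with \<open>w\<close> independent of \<open>z\<close>. At a
  \<open>k\<close>-th root of unity \<open>s\<close> with \<open>s\<^bsup>p (k - 1)\<^esup> = e\<^bsup>2\<pi>i/k\<^esup>\<close>, which exists by coprimality, the system is
  that of \<open>e\<^bsup>2\<pi>i/k\<^esup> z I - A\<close>, so \<open>\<phi>(e\<^bsup>2\<pi>i/k\<^esup> z)\<close> is a nonzero multiple of \<open>\<phi>(z)\<close>.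
\<close>

section \<open>Evaluation of multivariate polynomials\<close>

lemma prod_keys_superset:
  fixes c :: "'v \<Rightarrow> complex"
  assumes "finite S" "Poly_Mapping.keys m \<subseteq> S"
  shows "(\<Prod>v\<in>Poly_Mapping.keys m. c v ^ Poly_Mapping.lookup m v) =
    (\<Prod>v\<in>S. c v ^ Poly_Mapping.lookup m v)"
  using assms by (intro prod.mono_neutral_left) (auto simp: in_keys_iff)

lemma prod_keys_add:
  fixes c :: "'v \<Rightarrow> complex"
  shows "(\<Prod>v\<in>Poly_Mapping.keys (a + b). c v ^ Poly_Mapping.lookup (a + b) v) =
    (\<Prod>v\<in>Poly_Mapping.keys a. c v ^ Poly_Mapping.lookup a v) *
    (\<Prod>v\<in>Poly_Mapping.keys b. c v ^ Poly_Mapping.lookup b v)"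
proof -
  let ?S = "Poly_Mapping.keys a \<union> Poly_Mapping.keys b"
  have "finite ?S" "Poly_Mapping.keys (a + b) \<subseteq> ?S"
    by (auto dest: subsetD[OF keys_add])
  then show ?thesis
    using prod_keys_superset[of ?S "a + b" c] prod_keys_superset[of ?S a c] prod_keys_superset[of ?S b c]
    by (simp add: lookup_add power_add prod.distrib)
qed

lemma prod_keys_sum_list_single:
  fixes c :: "'v \<Rightarrow> complex"
  shows "(\<Prod>v\<in>Poly_Mapping.keys (\<Sum>j\<leftarrow>js. Poly_Mapping.single j (1::nat)).
      c v ^ Poly_Mapping.lookup (\<Sum>j\<leftarrow>js. Poly_Mapping.single j 1) v) = (\<Prod>j\<leftarrow>js. c j)"
proof (induction js)
  case (Cons a js)
  then show ?case
    by (simp only: list.map sum_list.Cons prod_list.Cons prod_keys_add) simp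
qed simp

lemma mpoly_eval_superset:
  assumes "finite S" "Poly_Mapping.keys P \<subseteq> S"
  shows "mpoly_eval P c = (\<Sum>m\<in>S. Poly_Mapping.lookup P m *
    (\<Prod>v\<in>Poly_Mapping.keys m. c v ^ Poly_Mapping.lookup m v))"
  unfolding mpoly_eval_def
  using assms by (intro sum.mono_neutral_left) (auto simp: in_keys_iff)

lemma mpoly_eval_0 [simp]: "mpoly_eval 0 c = 0"
  by (simp add: mpoly_eval_def)

lemma mpoly_eval_add: "mpoly_eval (P + Q) c = mpoly_eval P c + mpoly_eval Q c"
proof -
  let ?S = "Poly_Mapping.keys P \<union> Poly_Mapping.keys Q"
  have "finite ?S" "Poly_Mapping.keys (P + Q) \<subseteq> ?S"
    by (auto dest: subsetD[OF keys_add])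
  then show ?thesis
    using mpoly_eval_superset[of ?S "P + Q" c] mpoly_eval_superset[of ?S P c] mpoly_eval_superset[of ?S Q c]
    by (simp add: lookup_add sum.distrib ring_distribs)
qed

lemma mpoly_eval_sum: "mpoly_eval (\<Sum>i\<in>I. P i) c = (\<Sum>i\<in>I. mpoly_eval (P i) c)"
  by (induction I rule: infinite_finite_induct) (simp_all add: mpoly_eval_add)

lemma mpoly_eval_single:
  "mpoly_eval (Poly_Mapping.single m a) c =
    a * (\<Prod>v\<in>Poly_Mapping.keys m. c v ^ Poly_Mapping.lookup m v)"
  by (simp add: mpoly_eval_def)

text \<open>Once the coefficients of a system depend polynomially on \<open>s\<close> (outer
  variable) and \<open>z\<close> (inner variable), so does its resultant.\<close>

lemma mpoly_eval_poly2:
  fixes Q :: "'v \<Rightarrow> complex poly poly"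
  obtains G where "\<And>s z. poly (poly G [:s:]) z = mpoly_eval P (\<lambda>v. poly (poly (Q v) [:s:]) z)"
proof
  show "poly (poly (\<Sum>m\<in>Poly_Mapping.keys P. [:[:Poly_Mapping.lookup P m:]:] *
      (\<Prod>v\<in>Poly_Mapping.keys m. Q v ^ Poly_Mapping.lookup m v)) [:s:]) z =
      mpoly_eval P (\<lambda>v. poly (poly (Q v) [:s:]) z)" for s z
    by (simp add: mpoly_eval_def poly_sum poly_prod)
qed


section \<open>Univariate polynomials\<close>

text \<open>If 1 is a root, there are infinitely many roots and \<open>q\<close> is zero. Otherwise
  0 is the only possible root; splitting off its full power leaves a cofactor without roots, hence a
  constant.\<close>

lemma poly_monomial_if_zero_set_invariant:
  fixes q :: "complex poly"
  assumes "\<And>s. s \<noteq> 0 \<Longrightarrow> poly q s = 0 \<longleftrightarrow> poly q 1 = 0"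
  shows "\<exists>c w. q = monom c w"
proof (cases "poly q 1 = 0")
  case True
  then have "UNIV - {0} \<subseteq> {s. poly q s = 0}"
    using assms by blast
  moreover have "infinite (UNIV - {0 :: complex})"
    by (simp add: infinite_UNIV_char_0)
  ultimately have "infinite {s. poly q s = 0}"
    using finite_subset by blast
  then have "q = 0"
    using poly_roots_finite by blast
  then show ?thesis
    by (metis monom_eq_0)
next
  case False
  then have "q \<noteq> 0" by auto
  then obtain r where r: "q = [:- 0, 1:] ^ order 0 q * r" "\<not> [:- 0, 1:] dvd r"
    using order_decomp by metis
  have "poly r s \<noteq> 0" for s
  proof (cases "s = 0")
    case True
    then show ?thesis using r(2) poly_eq_0_iff_dvd[of r 0] by simp
  next
    case nz: False
    then have "poly q s \<noteq> 0" using assms False by blast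
    then show ?thesis by (subst (asm) r(1)) simp
  qed
  then have "constant (poly r)"
    using fundamental_theorem_of_algebra by blast
  then obtain c where "r = [:c:]"
    by (metis constant_degree degree_eq_zeroE)
  then have "q = monom c (order 0 q)"
    using r(1) by (simp add: monom_altdef mult.commute)
  then show ?thesis by blast
qed

text \<open>The exponent \<open>w\<close> does not depend on \<open>z\<close>: any two coefficients of \<open>G\<close> have a product that
  vanishes identically, so at most one of them is nonzero.\<close>

lemma poly2_monomial_if_zero_set_invariant:
  fixes G :: "complex poly poly"
  assumes "\<And>s z. s \<noteq> 0 \<Longrightarrow> poly (poly G [:s:]) z = 0 \<longleftrightarrow> poly (poly G [:1:]) z = 0"
  shows "\<exists>w. \<forall>s z. poly (poly G [:s:]) z = s ^ w * poly (poly G [:1:]) z"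
proof -
  have eval: "poly (poly G [:s:]) z = poly (map_poly (\<lambda>q. poly q z) G) s" for s z
    by (induction G) (simp_all add: map_poly_pCons)
  have "\<exists>c w. map_poly (\<lambda>q. poly q z) G = monom c w" for z
    using assms[of _ z] unfolding eval by (intro poly_monomial_if_zero_set_invariant) blast
  then have "poly (coeff G i * coeff G j) z = 0" if "i \<noteq> j" for i j z
    by (metis (no_types, lifting) that coeff_map_poly coeff_monom mult_zero_left mult_zero_right poly_0 poly_mult)
  then have prod: "coeff G i = 0 \<or> coeff G j = 0" if "i \<noteq> j" for i j
    using that by (metis mult_eq_0_iff poly_all_0_iff_0)
  \<comment> \<open>For nonzero \<open>G\<close> the degree serves as \<open>w\<close>; for
    \<open>G = 0\<close> any value does.\<close>
  obtain w where w: "\<And>i. i \<noteq> w \<Longrightarrow> coeff G i = 0"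
    using prod by (cases "G = 0") (auto, metis leading_coeff_0_iff)
  have "G = monom (coeff G w) w"
    by (rule poly_eqI) (use w in auto)
  then have "poly (poly G [:s:]) z = poly (poly (monom (coeff G w) w) [:s:]) z" for s z
    by (rule arg_cong)
  then have "poly (poly G [:s:]) z = s ^ w * poly (coeff G w) z" for s z
    by (simp add: poly_monom)
  then show ?thesis
    by (intro exI[of _ w]) simp
qed

text \<open>Over the complex numbers \<open>p\<close> splits, and composing with
  \<open>[:0, a:]\<close> turns each linear factor with root \<open>x\<close> into one with root
  \<open>x / a\<close>; the induction runs over the multiset of roots.\<close>

lemma image_mset_proots_pcompose_scale:
  fixes p :: "complex poly"
  assumes "a \<noteq> 0"
  shows "image_mset ((*) a) (proots (pcompose p [:0, a:])) = proots p"
proof (cases "p = 0")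
  case False
  have lin: "proots [:- x, a:] = {#x / a#}" for x
  proof -
    have "[:- x, a:] = smult a [:- (x / a), 1:]" using assms by simp
    then show ?thesis using assms by (metis proots_linear_factor proots_smult minus_minus)
  qed
  have nz: "pcompose (\<Prod>x\<in>#M. [:- x, 1:]) [:0, a:] \<noteq> 0" for M
    using assms by (auto simp: pcompose_eq_0_iff prod_mset_zero_iff)
  have "image_mset ((*) a) (proots (pcompose (\<Prod>x\<in>#M. [:- x, 1:]) [:0, a:])) = M" for M
  proof (induction M)
    case (add x M)
    have "pcompose [:- x, 1:] [:0, a:] = [:- x, a:]"
      by (simp add: pcompose_pCons)
    then show ?case
      using add assms nz[of M] by (simp add: pcompose_mult proots_mult lin del: pcompose_pCons mult_pCons_left mult_pCons_right)
  qed (simp add: pcompose_1)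
  from this[of "proots p"] have
    "image_mset ((*) a) (proots (pcompose (smult (lead_coeff p) (\<Prod>x\<in>#proots p. [:- x, 1:])) [:0, a:]))
      = proots p"
    using False by (simp add: pcompose_smult)
  then show ?thesis
    by (simp only: complex_poly_decompose_multiset)
qed simp


section \<open>Forms of a tensor\<close>

lemma mpoly_eval_tensor_form:
  "mpoly_eval (tensor_form m n T i) x =
    (\<Sum>js | length js = m - 1 \<and> set js \<subseteq> {1..n}. T (i # js) * (\<Prod>j\<leftarrow>js. x j))"
  unfolding tensor_form_def
  by (simp add: mpoly_eval_sum mpoly_eval_single prod_keys_sum_list_single del: One_nat_def)

lemma sum_list_single_in_exponents:
  assumes "length js = d" "set js \<subseteq> {1..n}"
  shows "(\<Sum>j\<leftarrow>js. Poly_Mapping.single j 1) \<in> exponents n d"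
proof -
  define \<alpha> where "\<alpha> = (\<Sum>j\<leftarrow>js. Poly_Mapping.single j (1::nat))"
  have "Poly_Mapping.keys \<alpha> \<subseteq> set js"
    unfolding \<alpha>_def by (induction js) (use keys_add in \<open>fastforce+\<close>)
  then have keys: "Poly_Mapping.keys \<alpha> \<subseteq> {1..n}"
    using assms by blast
  have "(\<Sum>j\<in>{1..n}. Poly_Mapping.lookup \<alpha> j) = length js"
    using assms(2) unfolding \<alpha>_def
    by (induction js) (simp_all add: lookup_add sum.distrib lookup_single when_def)
  moreover have "(\<Sum>j\<in>Poly_Mapping.keys \<alpha>. Poly_Mapping.lookup \<alpha> j) = (\<Sum>j\<in>{1..n}. Poly_Mapping.lookup \<alpha> j)"
    using keys by (intro sum.mono_neutral_left) (auto simp: in_keys_iff)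
  ultimately have "\<alpha> \<in> exponents n d"
    using keys assms(1) by (simp add: exponents_def)
  then show ?thesis
    by (simp add: \<alpha>_def)
qed

text \<open>Makes the zero criterion of \<open>is_resultant\<close> applicable, which speaks only of
  forms of the prescribed degrees.\<close>

lemma homogeneous_tensor_form: "homogeneous n (m - 1) (tensor_form m n T i)"
proof -
  have "Poly_Mapping.lookup (tensor_form m n T i) \<alpha> = 0" if "\<alpha> \<notin> exponents n (m - 1)" for \<alpha>
    unfolding tensor_form_def lookup_sum
    by (rule sum.neutral) (use that sum_list_single_in_exponents in \<open>auto simp: lookup_single when_def\<close>)
  then show ?thesis
    unfolding homogeneous_def by (auto simp: in_keys_iff)
qed

lemma lookup_tensor_form:
  "Poly_Mapping.lookup (tensor_form m n T i) \<alpha> =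
    (\<Sum>js | length js = m - 1 \<and> set js \<subseteq> {1..n}.
      T (i # js) * of_bool ((\<Sum>j\<leftarrow>js. Poly_Mapping.single j 1) = \<alpha>))"
  unfolding tensor_form_def lookup_sum
  by (rule sum.cong) (simp_all add: lookup_single when_def)

lemma system_coeffs_tensor_form_combination:
  assumes "\<And>i js. T (i # js) = f i * U (i # js) - g i * A (i # js)"
  shows "system_coeffs (tensor_form m n T) v =
    f (fst v) * system_coeffs (tensor_form m n U) v - g (fst v) * system_coeffs (tensor_form m n A) v"
  by (cases v) (simp add: system_coeffs_def lookup_tensor_form assms sum_distrib_left
      sum_subtractf left_diff_distrib mult.assoc)

text \<open>The hypothesis says that the new system arises by the invertible substitution of
  \<open>d j * x j\<close> for \<open>x j\<close> and by multiplying the forms by nonzero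
  constants.\<close>

lemma has_nontrivial_zero_scale:
  assumes "\<And>j. d j \<noteq> 0" "\<And>i. c i \<noteq> 0"
    and "\<And>i js. i \<in> {1..n} \<Longrightarrow> length js = m - 1 \<Longrightarrow> set js \<subseteq> {1..n} \<Longrightarrow>
      T' (i # js) = c i * T (i # js) * (\<Prod>j\<leftarrow>js. d j)"
  shows "has_nontrivial_zero n (tensor_form m n T') \<longleftrightarrow> has_nontrivial_zero n (tensor_form m n T)"
proof -
  have prod: "(\<Prod>j\<leftarrow>js. d j * x j) = (\<Prod>j\<leftarrow>js. d j) * (\<Prod>j\<leftarrow>js. x j)" for js x
    by (induction js) simp_all
  have eval: "mpoly_eval (tensor_form m n T' i) x =
      c i * mpoly_eval (tensor_form m n T i) (\<lambda>j. d j * x j)" if "i \<in> {1..n}" for i x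
    unfolding mpoly_eval_tensor_form sum_distrib_left prod
    by (rule sum.cong) (use that assms(3) in auto)
  show ?thesis
  proof
    assume "has_nontrivial_zero n (tensor_form m n T')"
    then obtain x where "\<exists>j\<in>{1..n}. x j \<noteq> 0" "\<forall>i\<in>{1..n}. mpoly_eval (tensor_form m n T' i) x = 0"
      unfolding has_nontrivial_zero_def by blast
    then show "has_nontrivial_zero n (tensor_form m n T)"
      unfolding has_nontrivial_zero_def
      by (intro exI[of _ "\<lambda>j. d j * x j"]) (use assms(1,2) eval in auto)
  next
    assume "has_nontrivial_zero n (tensor_form m n T)"
    then obtain x where "\<exists>j\<in>{1..n}. x j \<noteq> 0" "\<forall>i\<in>{1..n}. mpoly_eval (tensor_form m n T i) x = 0"
      unfolding has_nontrivial_zero_def by blast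
    then show "has_nontrivial_zero n (tensor_form m n T')"
      unfolding has_nontrivial_zero_def
      by (intro exI[of _ "\<lambda>j. x j / d j"]) (use assms(1,2) eval in auto)
  qed
qed


section \<open>The one-parameter deformation\<close>

locale hm_partition =
  fixes n k p :: nat and E :: "nat set set" and V1 :: "nat set"
  assumes k: "k \<ge> 2"
    and edge: "e \<in> E \<Longrightarrow> card e = k" "e \<in> E \<Longrightarrow> card (e \<inter> V1) = p"
begin

definition weight :: "nat \<Rightarrow> nat" where
  "weight j = of_bool (j \<in> V1)"

text \<open>The exponent at the unit tensor depends on the row \<open>hd is\<close>. The common
  factor \<open>s ^ (p * (k - 1))\<close> raises the power of \<open>s\<close> at the adjacency
  tensor from \<open>p\<close> to \<open>p * k\<close>, which is 1 at a \<open>k\<close>-th root of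
  unity.\<close>

definition deformed :: "complex \<Rightarrow> complex \<Rightarrow> tensor" where
  "deformed s z is = z * s ^ (k * weight (hd is) + p * (k - 1)) * unit_tensor is
     - s ^ (p * k) * adjacency_tensor k E is"

lemma deformed_1: "deformed 1 z = (\<lambda>is. z * unit_tensor is - adjacency_tensor k E is)"
  by (simp add: deformed_def fun_eq_iff)

lemma deformed_root_of_unity:
  assumes "s ^ k = 1"
  shows "deformed s z = deformed 1 (s ^ (p * (k - 1)) * z)"
proof -
  have "s ^ (k * a + b) = s ^ b" "s ^ (p * k) = 1" for a b
    using assms by (simp_all add: power_add power_mult mult.commute[of p k])
  then show ?thesis
    by (simp add: deformed_def fun_eq_iff)
qed

lemma sum_list_weight:
  assumes "set js \<in> E" "length js = k"
  shows "(\<Sum>j\<leftarrow>js. weight j) = p"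
proof -
  have "distinct js"
    using assms edge(1) by (intro card_distinct) auto
  then have "(\<Sum>j\<leftarrow>js. weight j) = (\<Sum>j\<in>set js. weight j)"
    by (simp add: sum_list_distinct_conv_sum_set)
  also have "\<dots> = card (set js \<inter> V1)"
    by (simp add: weight_def Int_def)
  finally show ?thesis
    using edge(2)[OF assms(1)] by simp
qed

text \<open>On the diagonal, \<open>js\<close> repeats \<open>i\<close> and contributes
  \<open>(k - 1) * weight i\<close>; on an edge, all weights together make \<open>p\<close>. At any
  other index list both tensors vanish.\<close>

lemma deformed_scale:
  assumes "length js = k - 1"
  shows "deformed s z (i # js) =
    s ^ (weight i + p * (k - 1)) * deformed 1 z (i # js) * (\<Prod>j\<leftarrow>js. s ^ weight j)"
proof -
  have prod: "(\<Prod>j\<leftarrow>js. s ^ weight j) = s ^ (\<Sum>j\<leftarrow>js. weight j)"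
    by (induction js) (simp_all add: power_add)
  have "s ^ (k * weight i + p * (k - 1)) * unit_tensor (i # js) =
      s ^ (weight i + p * (k - 1)) * unit_tensor (i # js) * s ^ (\<Sum>j\<leftarrow>js. weight j)"
  proof (cases "\<forall>j\<in>set js. j = i")
    case True
    then have "js = replicate (k - 1) i"
      using assms by (metis replicate_eqI)
    then have "(\<Sum>j\<leftarrow>js. weight j) = (k - 1) * weight i"
      by (simp add: sum_list_replicate)
    moreover have "k * weight i = weight i + (k - 1) * weight i"
      using k by (cases k) auto
    ultimately show ?thesis
      by (simp add: power_add)
  next
    case False
    then have "unit_tensor (i # js) = 0"
      by (auto simp: unit_tensor_def)
    then show ?thesis by simp
  qed
  moreover have "s ^ (p * k) * adjacency_tensor k E (i # js) =
      s ^ (weight i + p * (k - 1)) * adjacency_tensor k E (i # js) * s ^ (\<Sum>j\<leftarrow>js. weight j)"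
  proof (cases "set (i # js) \<in> E")
    case True
    then have "weight i + (\<Sum>j\<leftarrow>js. weight j) = p"
      using sum_list_weight[of "i # js"] assms k by simp
    moreover have "p * k = p + p * (k - 1)"
      using k by (cases k) auto
    ultimately have "s ^ (p * k) = s ^ (weight i + p * (k - 1)) * s ^ (\<Sum>j\<leftarrow>js. weight j)"
      by (metis add.assoc add.commute power_add)
    then show ?thesis by simp
  qed (simp add: adjacency_tensor_def)
  ultimately show ?thesis
    unfolding deformed_def list.sel prod power_one mult_1_right mult_1_left
    by (simp only: right_diff_distrib left_diff_distrib mult_ac)
qed

lemma tensor_det_deformed:
  "\<exists>w \<phi>. \<forall>s z. tensor_det k n (deformed s z) = s ^ w * poly \<phi> z"
proof (cases "\<exists>R. is_resultant n (\<lambda>_. k - 1) R")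
  case False
  \<comment> \<open>Without a resultant, \<open>resultant_poly\<close> takes its default value 0, so
    all determinants vanish.\<close>
  then have "tensor_det k n (deformed s z) = s ^ 0 * poly 0 z" for s z
    by (simp add: tensor_det_def resultant_def resultant_poly_def)
  then show ?thesis by blast
next
  case True
  define R where "R = resultant_poly n (\<lambda>_. k - 1)"
  have R: "is_resultant n (\<lambda>_. k - 1) R"
    using True unfolding R_def resultant_poly_def by (simp add: someI_ex)
  have det: "tensor_det k n T = mpoly_eval R (system_coeffs (tensor_form k n T))" for T
    by (simp add: tensor_det_def resultant_def R_def)
  have zero: "tensor_det k n T = 0 \<longleftrightarrow> has_nontrivial_zero n (tensor_form k n T)" for T
    using R homogeneous_tensor_form unfolding is_resultant_def det by blast
  \<comment> \<open>\<open>Q v\<close> is the coefficient \<open>v\<close> of the deformed system,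
    as a polynomial in \<open>s\<close> over polynomials in \<open>z\<close>; the unit tensor enters
    with a factor \<open>z\<close>, hence \<open>[:0, _:]\<close>.\<close>
  define Q where "Q = (\<lambda>v. monom [:0, system_coeffs (tensor_form k n unit_tensor) v:]
      (k * weight (fst v) + p * (k - 1))
    - monom [:system_coeffs (tensor_form k n (adjacency_tensor k E)) v:] (p * k))"
  have Q: "poly (poly (Q v) [:s:]) z = system_coeffs (tensor_form k n (deformed s z)) v" for v s z
    by (subst system_coeffs_tensor_form_combination[where U = unit_tensor and
          A = "adjacency_tensor k E" and f = "\<lambda>i. z * s ^ (k * weight i + p * (k - 1))" and
          g = "\<lambda>_. s ^ (p * k)"])
      (simp_all add: deformed_def Q_def poly_monom algebra_simps)
  obtain G where "\<And>s z. poly (poly G [:s:]) z = mpoly_eval R (\<lambda>v. poly (poly (Q v) [:s:]) z)"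
    using mpoly_eval_poly2 by blast
  then have G: "poly (poly G [:s:]) z = tensor_det k n (deformed s z)" for s z
    by (simp add: Q det)
  have "poly (poly G [:s:]) z = 0 \<longleftrightarrow> poly (poly G [:1:]) z = 0" if "s \<noteq> 0" for s z
    unfolding G zero
    by (rule has_nontrivial_zero_scale[where c = "\<lambda>i. s ^ (weight i + p * (k - 1))" and
          d = "\<lambda>j. s ^ weight j"])
      (simp_all add: that deformed_scale[of _ s])
  then obtain w where "\<forall>s z. poly (poly G [:s:]) z = s ^ w * poly (poly G [:1:]) z"
    using poly2_monomial_if_zero_set_invariant by blast
  then have "tensor_det k n (deformed s z) = s ^ w * poly (poly G [:1:]) z" for s z
    unfolding G[of s, symmetric] by blast
  then show ?thesis
    by blast
qed

lemma k_symmetric_hypergraph_spectrum: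
  assumes "coprime p k"
  shows "k_symmetric k (hypergraph_spectrum n k E)"
proof -
  obtain w \<phi> where \<phi>: "\<And>s z. tensor_det k n (deformed s z) = s ^ w * poly \<phi> z"
    using tensor_det_deformed by auto
  \<comment> \<open>The case \<open>s = 1\<close> gives the values of \<phi>, and these determine
    it.\<close>
  have char_poly: "tensor_char_poly k n (adjacency_tensor k E) = \<phi>"
    unfolding tensor_char_poly_def deformed_1[symmetric]
    by (rule the_equality) (simp_all add: \<phi> poly_eq_poly_eq_iff[symmetric] fun_eq_iff)
  define \<zeta> where "\<zeta> = cis (2 * pi / real k)"
  have \<zeta>: "\<zeta> \<noteq> 0" "\<zeta> ^ k = 1"
    using k by (simp_all add: \<zeta>_def DeMoivre)
  \<comment> \<open>As \<open>k - 1\<close> is also coprime to \<open>k\<close>, the exponent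
    \<open>p * (k - 1)\<close> has an inverse \<open>u\<close> modulo \<open>k\<close>, so
    \<open>\<zeta> ^ u\<close> is the required root of unity.\<close>
  have "coprime (p * (k - 1)) k"
    using assms k coprime_diff_one_left_nat[of k] by simp
  then obtain u where u: "[p * (k - 1) * u = 1] (mod k)"
    using cong_solve_coprime_nat by (metis One_nat_def)
  have \<zeta>_mod: "\<zeta> ^ a = \<zeta> ^ (a mod k)" for a
  proof -
    have "\<zeta> ^ a = \<zeta> ^ (k * (a div k) + a mod k)" by simp
    also have "\<dots> = (\<zeta> ^ k) ^ (a div k) * \<zeta> ^ (a mod k)" by (simp only: power_add power_mult)
    finally show ?thesis by (simp add: \<zeta>(2))
  qed
  define s where "s = \<zeta> ^ u"
  have s: "s \<noteq> 0" "s ^ k = 1"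
    using \<zeta> unfolding s_def power_mult[symmetric] mult.commute[of u]
    by (simp_all add: power_mult)
  have "s ^ (p * (k - 1)) = \<zeta> ^ (p * (k - 1) * u)"
    unfolding s_def power_mult[symmetric] mult.commute[of u] ..
  also have "\<dots> = \<zeta>"
    using \<zeta>_mod[of "p * (k - 1) * u"] \<zeta>_mod[of 1] u unfolding cong_def by simp
  finally have s_power: "s ^ (p * (k - 1)) = \<zeta>" .
  \<comment> \<open>The parameters \<open>(s, z)\<close> and \<open>(1, \<zeta> * z)\<close> give
    the same tensor, so its determinant is computed in two ways.\<close>
  have "poly \<phi> (\<zeta> * z) = s ^ w * poly \<phi> z" for z
    using \<phi>[of s z] \<phi>[of 1 "\<zeta> * z"] deformed_root_of_unity[OF s(2)] s_power by simp
  then have "pcompose \<phi> [:0, \<zeta>:] = smult (s ^ w) \<phi>"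
    by (simp add: poly_eq_poly_eq_iff[symmetric] fun_eq_iff poly_pcompose mult.commute)
  then have "proots (pcompose \<phi> [:0, \<zeta>:]) = proots \<phi>"
    using s(1) by simp
  then show ?thesis
    unfolding k_symmetric_def hypergraph_spectrum_def tensor_spectrum_def char_poly \<zeta>_def[symmetric]
    using image_mset_proots_pcompose_scale[OF \<zeta>(1), of \<phi>] by simp
qed

end

theorem theorem3p2:
  fixes n k p :: nat and E :: "nat set set"
  assumes "k \<ge> 2"
    and "hm_bipartite n k p E"
    and "coprime p k"
  shows "k_symmetric k (hypergraph_spectrum n k E)"
proof -
  from assms(2) obtain V1 where "\<forall>e\<in>E. card (e \<inter> V1) = p"
    unfolding hm_bipartite_def by blast
  with assms(1,2) interpret hm_partition n k p E V1
    by unfold_locales (auto simp: hm_bipartite_def uniform_hypergraph_def)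
  from assms(3) show ?thesis
    by (rule k_symmetric_hypergraph_spectrum)
qed

end
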